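(* Let $\hat x\in\mathbb S^{d-1}$. (i) If $\hat x$ is non-observable, then $\phi_y^{(\hat x)}\notin\mathrm{Range}(\mathcal L^{(\hat x)})$ for all $y\in\mathbb R^d$. (ii) If $\hat x$ is an observable direction, then $\phi_y^{(\hat x)}\in\mathrm{Range}(\mathcal L^{(\hat x)})$ if and only if $y\in K_\Gamma^{(\hat x)}$.
   Context: Let $d\in\{2,3\}$, $0<t_{\min}<t_{\max}$, $T=t_{\max}-t_{\min}$, $K>0$, $a\in C^1([t_{\min},t_{\max}];\mathbb R^d)$ and $\Gamma=\{a(t):t\in[t_{\min},t_{\max}]\}$. For $\hat x\in\mathbb S^{d-1}$, the data-to-pattern operator $\mathcal L^{(\hat x)}:L^2(t_{\min},t_{\max})\to L^2(0,K)$ is $$(\mathcal L^{(\hat x)}\psi)(\tau)=\int_{t_{\min}}^{t_{\max}}e^{-i\tau(t+\hat x\cdot a(t))}\psi(t)\,dt,\quad\tau\in(0,K).$$ The test function is $\phi_y^{(\hat x)}(k)=\frac1{|t_{\max}-t_{\min}|}\int_{t_{\min}}^{t_{\max}}e^{-ik(\hat x\cdot y+t)}\,dt$, $k\in(0,K)$, for $y\in\mathbb R^d$. Put $h(t)=\hat x\cdot a(t)+t$, $\xi_{\min}^{(\hat x)}=\inf_{[t_{\min},t_{\max}]}h$, $\xi_{\max}^{(\hat x)}=\sup_{[t_{\min},t_{\max}]}h$. The direction $\hat x$ is called observable if $\xi_{\max}^{(\hat x)}-\xi_{\min}^{(\hat x)}\ge T$ and non-observable if $\xi_{\max}^{(\hat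 x)}-\xi_{\min}^{(\hat x)}<T$. For observable $\hat x$, $$K_\Gamma^{(\hat x)}=\{y\in\mathbb R^d:\ \xi_{\min}^{(\hat x)}-t_{\min}\le\hat x\cdot y\le\xi_{\max}^{(\hat x)}-t_{\max}\}.$$ *)

theory Defs
  imports "HOL-Analysis.Analysis"
begin

text \<open>
  Elements of \<open>L\<^sup>2(S)\<close> are represented by complex-valued functions on \<open>\<real>\<close>, whose values
  outside \<open>S\<close> are irrelevant; functions that agree almost everywhere on \<open>S\<close> represent the same
  element.
\<close>

definition L2_space :: "real set \<Rightarrow> (real \<Rightarrow> complex) set" where
  "L2_space S = {f. f \<in> borel_measurable (lebesgue_on S) \<and>
                    integrable (lebesgue_on S) (\<lambda>x. (norm (f x))\<^sup>2)}"

text \<open>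
  Derivatives are taken within the closed interval, so that they are one-sided at the end points
  and nothing is assumed about the values of \<open>f\<close> outside. (The library predicate
  \<open>C1_differentiable_on\<close> uses two-sided derivatives.)
\<close>

definition C1_on_interval :: "real \<Rightarrow> real \<Rightarrow> (real \<Rightarrow> 'v::real_normed_vector) \<Rightarrow> bool" where
  "C1_on_interval l u f \<longleftrightarrow>
     (\<exists>f'. (\<forall>t\<in>{l..u}. (f has_vector_derivative f' t) (at t within {l..u})) \<and>
           continuous_on {l..u} f')"

definition data_to_pattern ::
  "(real \<Rightarrow> real ^ 'd) \<Rightarrow> real \<Rightarrow> real \<Rightarrow> real ^ 'd \<Rightarrow> (real \<Rightarrow> complex) \<Rightarrow> real \<Rightarrow> complex" where
  "data_to_pattern a tmin tmax xhat \<psi> \<tau> =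
     (LINT t|lebesgue_on {tmin..tmax}.
        exp (- \<i> * of_real \<tau> * of_real (t + xhat \<bullet> a t)) * \<psi> t)"

text \<open>
  The range as a subset of \<open>L\<^sup>2(0,K)\<close>; the identity between a function and an image under the
  operator is an identity in \<open>L\<^sup>2(0,K)\<close>, i.e. it holds almost everywhere.
\<close>

definition data_to_pattern_range ::
  "(real \<Rightarrow> real ^ 'd) \<Rightarrow> real \<Rightarrow> real \<Rightarrow> real \<Rightarrow> real ^ 'd \<Rightarrow> (real \<Rightarrow> complex) set" where
  "data_to_pattern_range a tmin tmax K xhat =
     {f \<in> L2_space {0<..<K}. \<exists>\<psi> \<in> L2_space {tmin<..<tmax}.
        AE \<tau> in lebesgue_on {0<..<K}. f \<tau> = data_to_pattern a tmin tmax xhat \<psi> \<tau>}"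

definition test_function ::
  "real \<Rightarrow> real \<Rightarrow> real ^ 'd \<Rightarrow> real ^ 'd \<Rightarrow> real \<Rightarrow> complex" where
  "test_function tmin tmax xhat y k =
     of_real (1 / \<bar>tmax - tmin\<bar>) *
     (LINT t|lebesgue_on {tmin..tmax}. exp (- \<i> * of_real k * of_real (xhat \<bullet> y + t)))"

definition xi_min :: "(real \<Rightarrow> real ^ 'd) \<Rightarrow> real \<Rightarrow> real \<Rightarrow> real ^ 'd \<Rightarrow> real" where
  "xi_min a tmin tmax xhat = (INF t\<in>{tmin..tmax}. xhat \<bullet> a t + t)"

definition xi_max :: "(real \<Rightarrow> real ^ 'd) \<Rightarrow> real \<Rightarrow> real \<Rightarrow> real ^ 'd \<Rightarrow> real" where
  "xi_max a tmin tmax xhat = (SUP t\<in>{tmin..tmax}. xhat \<bullet> a t + t)"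

definition observable :: "(real \<Rightarrow> real ^ 'd) \<Rightarrow> real \<Rightarrow> real \<Rightarrow> real ^ 'd \<Rightarrow> bool" where
  "observable a tmin tmax xhat \<longleftrightarrow>
     xi_max a tmin tmax xhat - xi_min a tmin tmax xhat \<ge> tmax - tmin"

definition non_observable :: "(real \<Rightarrow> real ^ 'd) \<Rightarrow> real \<Rightarrow> real \<Rightarrow> real ^ 'd \<Rightarrow> bool" where
  "non_observable a tmin tmax xhat \<longleftrightarrow>
     xi_max a tmin tmax xhat - xi_min a tmin tmax xhat < tmax - tmin"

definition K_Gamma :: "(real \<Rightarrow> real ^ 'd) \<Rightarrow> real \<Rightarrow> real \<Rightarrow> real ^ 'd \<Rightarrow> (real ^ 'd) set" where
  "K_Gamma a tmin tmax xhat =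
     {y. xi_min a tmin tmax xhat - tmin \<le> xhat \<bullet> y \<and>
         xhat \<bullet> y \<le> xi_max a tmin tmax xhat - tmax}"

end

theory Submission
  imports Defs "HOL-Complex_Analysis.Conformal_Mappings"
begin

text \<open>
  Put \<open>h t = t + xhat \<bullet> a t\<close>, let \<open>I\<close> be the time interval and \<open>J\<close> the interval \<open>I + xhat \<bullet> y\<close>.
  Up to the factor \<open>1/T\<close>, the test function is the Fourier transform of the indicator of \<open>J\<close>, while
  the operator maps \<open>\<psi>\<close> to the Fourier transform of the push-forward of \<open>\<psi> dt\<close> under \<open>h\<close>. Both
  transforms are entire, so agreement on \<open>(0,K)\<close> forces all moments to agree; by Weierstrass the two
  measures integrate the function \<open>dist(\<cdot>, h I)\<close> to the same value, namely 0, whence \<open>J \<subseteq> h I\<close>.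
  Conversely, if \<open>J \<subseteq> h I\<close>, then \<open>h\<close> maps some Borel set \<open>S \<subseteq> I\<close> bijectively onto \<open>J\<close>, and
  \<open>\<psi> = \<bar>h'\<bar> 1\<^sub>S / T\<close> is a bounded preimage by the change of variables formula. Hence the test function
  is in the range iff \<open>J \<subseteq> h I\<close>.
\<close>

section \<open>Fourier transforms as entire power series, and recovery of moments\<close>

lemma integrable_of_real_power_mult:
  fixes h :: "'a \<Rightarrow> real" and w :: "'a \<Rightarrow> complex"
  assumes w: "integrable M w" and h[measurable]: "h \<in> borel_measurable M"
    and B: "\<And>x. x \<in> space M \<Longrightarrow> \<bar>h x\<bar> \<le> B"
  shows "integrable M (\<lambda>x. of_real (h x) ^ n * w x)"
proof (rule Bochner_Integration.integrable_bound)
  have [measurable]: "w \<in> borel_measurable M" using w by auto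
  show "(\<lambda>x. of_real (h x) ^ n * w x) \<in> borel_measurable M" by measurable
  show "integrable M (\<lambda>x. B ^ n *\<^sub>R w x)" using w by simp
  show "AE x in M. norm (of_real (h x) ^ n * w x) \<le> norm (B ^ n *\<^sub>R w x)"
  proof (rule AE_I2)
    fix x assume x: "x \<in> space M"
    have "\<bar>h x\<bar> ^ n \<le> \<bar>B\<bar> ^ n"
      by (rule power_mono) (use B[OF x] in auto)
    then show "norm (of_real (h x) ^ n * w x) \<le> norm (B ^ n *\<^sub>R w x)"
      by (auto simp: norm_mult norm_power power_abs intro: mult_right_mono)
  qed
qed

text \<open>Expand the exponential and integrate termwise: \<open>h\<close> is bounded, so the
  integrals of the norms of the terms are dominated by an exponential series. As \<open>z\<close> is
  complex, this is the entire extension of the transform; its Taylor coefficients are the moments of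
  \<open>w\<close> along \<open>h\<close>, up to nonzero factors.\<close>

lemma fourier_transform_sums:
  fixes h :: "'a \<Rightarrow> real" and w :: "'a \<Rightarrow> complex" and z :: complex
  assumes w: "integrable M w" and h: "h \<in> borel_measurable M"
    and B: "\<And>x. x \<in> space M \<Longrightarrow> \<bar>h x\<bar> \<le> B"
  shows "(\<lambda>n. (- \<i>) ^ n / fact n * (LINT x|M. of_real (h x) ^ n * w x) * z ^ n) sums
           (LINT x|M. exp (- \<i> * z * of_real (h x)) * w x)"
proof -
  define f where "f n x = ((- \<i>) ^ n / fact n * z ^ n) * (of_real (h x) ^ n * w x)" for n x
  \<comment> \<open>\<open>B\<close> may be negative when \<open>space M\<close> is empty, hence the
    absolute value.\<close>
  define C where "C = \<bar>B\<bar>"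
  have f_alt: "f n x = (- \<i> * z * of_real (h x)) ^ n /\<^sub>R fact n * w x" for n x
  proof -
    have "(- \<i> * z * of_real (h x)) ^ n = (- \<i>) ^ n * z ^ n * of_real (h x) ^ n"
      by (simp only: power_mult_distrib)
    then show ?thesis by (simp add: f_def scaleR_conv_of_real divide_inverse mult_ac)
  qed
  have int: "integrable M (f n)" for n
    unfolding f_def using integrable_of_real_power_mult[OF w h B] by simp
  have f_sums: "(\<lambda>n. f n x) sums (exp (- \<i> * z * of_real (h x)) * w x)" for x
    unfolding f_alt by (intro sums_mult2 exp_converges)
  have f_le: "norm (f n x) \<le> (norm z * C) ^ n /\<^sub>R fact n * norm (w x)" if "x \<in> space M" for n x
  proof -
    have "norm (f n x) = (norm z * \<bar>h x\<bar>) ^ n /\<^sub>R fact n * norm (w x)"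
      unfolding f_alt by (simp add: norm_mult norm_power)
    also have "\<dots> \<le> (norm z * C) ^ n /\<^sub>R fact n * norm (w x)"
      using B[OF that] unfolding C_def
      by (auto intro!: mult_right_mono mult_left_mono power_mono)
    finally show ?thesis .
  qed
  have "(\<lambda>n. integral\<^sup>L M (f n)) sums (LINT x|M. (\<Sum>n. f n x))"
  proof (rule sums_integral[OF int])
    have "summable (\<lambda>n. norm (f n x))" for x
      unfolding f_alt norm_mult by (intro summable_mult2 summable_norm_exp)
    then show "AE x in M. summable (\<lambda>n. norm (f n x))" by simp
    show "summable (\<lambda>n. LINT x|M. norm (f n x))"
    proof (rule summable_comparison_test)
      show "summable (\<lambda>n. (norm z * C) ^ n /\<^sub>R fact n * (LINT x|M. norm (w x)))"
        by (intro summable_mult2 summable_exp_generic)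
      have "norm (LINT x|M. norm (f n x)) \<le> (norm z * C) ^ n /\<^sub>R fact n * (LINT x|M. norm (w x))" for n
      proof -
        have "(LINT x|M. norm (f n x)) \<le> (LINT x|M. (norm z * C) ^ n /\<^sub>R fact n * norm (w x))"
          using int w f_le by (intro integral_mono) auto
        then show ?thesis by simp
      qed
      then show "\<exists>N. \<forall>n\<ge>N. norm (LINT x|M. norm (f n x))
          \<le> (norm z * C) ^ n /\<^sub>R fact n * (LINT x|M. norm (w x))" by blast
    qed
  qed
  moreover have "integral\<^sup>L M (f n) = (- \<i>) ^ n / fact n * (LINT x|M. of_real (h x) ^ n * w x) * z ^ n" for n
    unfolding f_def by simp
  moreover have "(\<Sum>n. f n x) = exp (- \<i> * z * of_real (h x)) * w x" for x
    using f_sums by (rule sums_unique[symmetric])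
  ultimately show ?thesis by simp
qed

text \<open>The series converges on the whole plane, so \<open>f\<close> is entire and vanishes
  identically by analytic continuation from \<open>U\<close>; uniqueness of power series
  coefficients does the rest.\<close>

lemma entire_powser_eq_0:
  fixes c :: "nat \<Rightarrow> complex"
  assumes sums: "\<And>z. (\<lambda>n. c n * z ^ n) sums f z"
    and lim: "z0 islimpt U" and zero: "\<And>z. z \<in> U \<Longrightarrow> f z = 0"
  shows "c n = 0"
proof -
  have "f holomorphic_on ball 0 r" for r
    by (rule power_series_holomorphic[where a = c]) (use sums in simp)
  then have "f holomorphic_on (\<Union>r. ball 0 r)"
    by (intro holomorphic_on_UN_open) auto
  then have hol: "f holomorphic_on UNIV"
    by (metis (no_types) UNIV_I UNIV_eq_I UN_iff dist_norm diff_zero mem_ball dist_commute gt_ex)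
  have f0: "f z = 0" for z
    by (rule analytic_continuation[OF hol open_UNIV connected_UNIV subset_UNIV UNIV_I lim zero UNIV_I])
  have "c 0 = f 0"
    using sums_unique2[OF sums[of 0] powser_sums_zero[of c]] by simp
  then have "c 0 = 0" using f0 by simp
  \<comment> \<open>A nonzero coefficient would make the zero function nonzero on a punctured disc.
    \<open>powser_0_nonzero\<close> speaks of positive indices, so \<open>c 0\<close> was treated
    separately.\<close>
  moreover have "c m = 0" if m: "m > 0" for m
  proof (rule ccontr)
    assume cm: "c m \<noteq> 0"
    have zero_sums: "(\<lambda>n. c n * (z - 0) ^ n) sums 0" for z
      using sums[of z] f0[of z] by simp
    obtain s where s: "0 < s" "\<And>z::complex. z \<in> cball 0 s - {0} \<Longrightarrow> (0::complex) \<noteq> 0"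
      by (rule powser_0_nonzero[of 1 0 c "\<lambda>_. 0", OF _ zero_sums _ cm m]) auto
    show False using s(2)[of "of_real s"] s(1) by simp
  qed
  ultimately show ?thesis by (cases "n = 0") auto
qed

text \<open>A property that holds almost everywhere on \<open>(0,K)\<close> cannot fail throughout
  an interval \<open>(0,d)\<close> inside it, which has positive measure. The points found near 0
  serve as the zero set for analytic continuation.\<close>

lemma AE_interval_islimpt:
  fixes K :: real
  assumes "K > 0" and "AE x in lebesgue_on {0<..<K}. P x"
  shows "(0::complex) islimpt {of_real x |x. 0 < x \<and> P x}"
proof (subst islimpt_approachable, intro allI impI)
  fix e :: real assume "e > 0"
  define d where "d = min e K"
  have d: "0 < d" "d \<le> e" "d \<le> K" using \<open>e > 0\<close> assms(1) by (auto simp: d_def)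
  have "\<exists>x\<in>{0<..<d}. P x"
  proof (rule ccontr)
    assume "\<not> ?thesis"
    then have no: "\<And>x. x \<in> {0<..<d} \<Longrightarrow> \<not> P x" by blast
    have "AE x in lebesgue. x \<in> {0<..<K} \<longrightarrow> P x"
      using assms(2) by (simp add: AE_restrict_space_iff)
    then have "AE x in lebesgue. x \<notin> {0<..<d}"
      by (rule AE_mp) (use no d in auto)
    then have "{0<..<d} \<in> null_sets lebesgue"
      by (subst (asm) AE_iff_null_sets[symmetric]) auto
    then have "negligible {0<..<d}" by (simp add: negligible_iff_null_sets)
    then show False using d(1) by (metis negligible_interval(2) box_real(1) box_ne_empty(2) greaterThanLessThan_empty_iff not_le)
  qed
  then obtain x where "x \<in> {0<..<d}" "P x" by blast
  then show "\<exists>x'\<in>{of_real x |x. 0 < x \<and> P x}. x' \<noteq> 0 \<and> dist x' (0::complex) < e"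
    using d by (intro bexI[of _ "of_real x"]) auto
qed

text \<open>The difference of the two transforms is an everywhere convergent power series whose
  zeros accumulate at 0. Hence all its coefficients vanish, and the common nonzero factor of the two
  moments cancels.\<close>

lemma moments_eq_of_fourier_eq:
  fixes h :: "'a \<Rightarrow> real" and w :: "'a \<Rightarrow> complex" and k :: "'b \<Rightarrow> real" and v :: "'b \<Rightarrow> complex"
  assumes "integrable M w" "h \<in> borel_measurable M" "\<And>x. x \<in> space M \<Longrightarrow> \<bar>h x\<bar> \<le> B"
    and "integrable N v" "k \<in> borel_measurable N" "\<And>x. x \<in> space N \<Longrightarrow> \<bar>k x\<bar> \<le> B"
    and "K > 0"
    and AE: "AE \<tau> in lebesgue_on {0<..<K}.
      (LINT x|M. exp (- \<i> * of_real \<tau> * of_real (h x)) * w x) =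
      (LINT x|N. exp (- \<i> * of_real \<tau> * of_real (k x)) * v x)"
  shows "(LINT x|M. of_real (h x) ^ n * w x) = (LINT x|N. of_real (k x) ^ n * v x)"
proof -
  define c where "c n = (- \<i>) ^ n / fact n * (LINT x|M. of_real (h x) ^ n * w x)
                      - (- \<i>) ^ n / fact n * (LINT x|N. of_real (k x) ^ n * v x)" for n
  define f where "f z = (LINT x|M. exp (- \<i> * z * of_real (h x)) * w x)
                      - (LINT x|N. exp (- \<i> * z * of_real (k x)) * v x)" for z
  have sums: "(\<lambda>n. c n * z ^ n) sums f z" for z
    using sums_diff[OF fourier_transform_sums[OF assms(1-3)] fourier_transform_sums[OF assms(4-6)], of z]
    unfolding c_def f_def by (simp add: left_diff_distrib)
  have "AE \<tau> in lebesgue_on {0<..<K}. f (of_real \<tau>) = 0"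
    using AE by eventually_elim (simp add: f_def)
  from AE_interval_islimpt[OF \<open>K > 0\<close> this]
  have "c n = 0"
    by (rule entire_powser_eq_0[OF sums]) auto
  then show ?thesis
    unfolding c_def by (simp flip: right_diff_distrib)
qed

section \<open>From equal moments to equal integrals of continuous functions\<close>

text \<open>The estimate for a single measure, to be applied to each of the two measures under
  comparison: a polynomial integrand yields a combination of moments, and replacing \<open>g\<close>
  by \<open>p\<close> costs at most \<open>e\<close> times the integral of
  \<open>norm (u x)\<close>.\<close>

lemma integral_polynomial_approx:
  fixes l :: "'a \<Rightarrow> real" and u :: "'a \<Rightarrow> complex"
  assumes u: "integrable Q u" and l[measurable]: "l \<in> borel_measurable Q"
    and lB: "\<And>x. x \<in> space Q \<Longrightarrow> \<bar>l x\<bar> \<le> B"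
    and [measurable]: "g \<in> borel_measurable borel"
    and p_eq: "p = (\<lambda>x. \<Sum>i\<le>m. a i * x ^ i)"
    and p: "\<And>x. x \<in> {-B..B} \<Longrightarrow> \<bar>g x - p x\<bar> < e"
  shows "(LINT x|Q. of_real (p (l x)) * u x) = (\<Sum>i\<le>m. of_real (a i) * (LINT x|Q. of_real (l x) ^ i * u x))"
    and "norm ((LINT x|Q. of_real (g (l x)) * u x) - (LINT x|Q. of_real (p (l x)) * u x)) \<le> e * (LINT x|Q. norm (u x))"
proof -
  note ip = integrable_of_real_power_mult[OF u l lB]
  have [measurable]: "u \<in> borel_measurable Q" using u by auto
  have eq: "of_real (p (l x)) * u x = (\<Sum>i\<le>m. of_real (a i) * (of_real (l x) ^ i * u x))" for x
    by (simp add: p_eq sum_distrib_right mult.assoc)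
  have i2: "integrable Q (\<lambda>x. of_real (p (l x)) * u x)"
    unfolding eq by (intro Bochner_Integration.integrable_sum integrable_mult_right ip)
  have i3: "(LINT x|Q. of_real (p (l x)) * u x) = (\<Sum>i\<le>m. of_real (a i) * (LINT x|Q. of_real (l x) ^ i * u x))"
    unfolding eq by (subst Bochner_Integration.integral_sum) (auto intro: ip)
  have le: "norm (of_real (g (l x) - p (l x)) * u x) \<le> e * norm (u x)" if "x \<in> space Q" for x
  proof -
    have "\<bar>g (l x) - p (l x)\<bar> \<le> e"
      using lB[OF that] by (intro less_imp_le p) (simp add: abs_le_iff)
    then show ?thesis by (auto simp: norm_mult simp flip: of_real_diff intro!: mult_right_mono)
  qed
  have [measurable]: "p \<in> borel_measurable borel" unfolding p_eq by measurable
  \<comment> \<open>The error term is dominated by a multiple of \<open>u\<close>. Adding the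
    polynomial term \<open>i2\<close> back gives integrability of the full integrand in
    \<open>i1\<close>.\<close>
  have i4: "integrable Q (\<lambda>x. of_real (g (l x) - p (l x)) * u x)"
  proof (rule Bochner_Integration.integrable_bound)
    show "integrable Q (\<lambda>x. e *\<^sub>R u x)" using u by simp
    show "AE x in Q. norm (of_real (g (l x) - p (l x)) * u x) \<le> norm (e *\<^sub>R u x)"
      using order_trans[OF le mult_right_mono[OF abs_ge_self]] by (intro AE_I2) simp
  qed measurable
  have i1: "integrable Q (\<lambda>x. of_real (g (l x)) * u x)"
    using Bochner_Integration.integrable_add[OF i4 i2] by (simp add: algebra_simps)
  have "(LINT x|Q. of_real (g (l x)) * u x) - (LINT x|Q. of_real (p (l x)) * u x)
      = (LINT x|Q. of_real (g (l x) - p (l x)) * u x)"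
    by (subst Bochner_Integration.integral_diff[symmetric, OF i1 i2]) (simp add: algebra_simps)
  also have "norm \<dots> \<le> (LINT x|Q. norm (of_real (g (l x) - p (l x)) * u x))"
    by (rule integral_norm_bound)
  also have "\<dots> \<le> (LINT x|Q. e * norm (u x))"
    using i4 u le by (intro integral_mono) auto
  finally show "norm ((LINT x|Q. of_real (g (l x)) * u x) - (LINT x|Q. of_real (p (l x)) * u x)) \<le> e * (LINT x|Q. norm (u x))"
    by simp
  show "(LINT x|Q. of_real (p (l x)) * u x) = (\<Sum>i\<le>m. of_real (a i) * (LINT x|Q. of_real (l x) ^ i * u x))"
    by (rule i3)
qed

text \<open>By Weierstrass, \<open>g\<close> is uniformly close to a polynomial on
  \<open>{-B..B}\<close>, which contains the values of \<open>h\<close> and \<open>k\<close>. The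
  polynomial has the same integral on both sides, so the two integrals of \<open>g\<close> differ by
  arbitrarily little.\<close>

lemma integral_continuous_eq_of_moments_eq:
  fixes h :: "'a \<Rightarrow> real" and w :: "'a \<Rightarrow> complex" and k :: "'b \<Rightarrow> real" and v :: "'b \<Rightarrow> complex"
  assumes w: "integrable M w" and h[measurable]: "h \<in> borel_measurable M"
    and hB: "\<And>x. x \<in> space M \<Longrightarrow> \<bar>h x\<bar> \<le> B"
    and v: "integrable N v" and k[measurable]: "k \<in> borel_measurable N"
    and kB: "\<And>x. x \<in> space N \<Longrightarrow> \<bar>k x\<bar> \<le> B"
    and mom: "\<And>n. (LINT x|M. of_real (h x) ^ n * w x) = (LINT x|N. of_real (k x) ^ n * v x)"
    and g: "continuous_on UNIV g"
  shows "(LINT x|M. of_real (g (h x)) * w x) = (LINT x|N. of_real (g (k x)) * v x)"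
proof -
  have gm: "g \<in> borel_measurable borel"
    using g by (rule borel_measurable_continuous_onI)
  define D where "D = (LINT x|M. norm (w x)) + (LINT x|N. norm (v x))"
  have D: "D \<ge> 0" unfolding D_def by simp
  have approx: "norm ((LINT x|M. of_real (g (h x)) * w x) - (LINT x|N. of_real (g (k x)) * v x)) \<le> e * D"
    if e: "e > 0" for e
  proof -
    obtain p where p: "real_polynomial_function p" "\<And>x. x \<in> {-B..B} \<Longrightarrow> \<bar>g x - p x\<bar> < e"
      using Stone_Weierstrass_real_polynomial_function[OF compact_Icc continuous_on_subset[OF g subset_UNIV] e, of "-B" B]
      by metis
    obtain a m where p_eq: "p = (\<lambda>x. \<Sum>i\<le>m. a i * x ^ i)"
      using p(1) real_polynomial_function_iff_sum by auto
    have M: "(LINT x|M. of_real (p (h x)) * w x) = (\<Sum>i\<le>m. of_real (a i) * (LINT x|M. of_real (h x) ^ i * w x))"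
      "norm ((LINT x|M. of_real (g (h x)) * w x) - (LINT x|M. of_real (p (h x)) * w x)) \<le> e * (LINT x|M. norm (w x))"
      by (rule integral_polynomial_approx[OF w h hB gm p_eq p(2)]; assumption)+
    have N: "(LINT x|N. of_real (p (k x)) * v x) = (\<Sum>i\<le>m. of_real (a i) * (LINT x|N. of_real (k x) ^ i * v x))"
      "norm ((LINT x|N. of_real (g (k x)) * v x) - (LINT x|N. of_real (p (k x)) * v x)) \<le> e * (LINT x|N. norm (v x))"
      by (rule integral_polynomial_approx[OF v k kB gm p_eq p(2)]; assumption)+
    have "(LINT x|M. of_real (p (h x)) * w x) = (LINT x|N. of_real (p (k x)) * v x)"
      unfolding M(1) N(1) using mom by (intro sum.cong) auto
    then have "(LINT x|M. of_real (g (h x)) * w x) - (LINT x|N. of_real (g (k x)) * v x) =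
      ((LINT x|M. of_real (g (h x)) * w x) - (LINT x|M. of_real (p (h x)) * w x)) -
      ((LINT x|N. of_real (g (k x)) * v x) - (LINT x|N. of_real (p (k x)) * v x))" by simp
    also have "norm \<dots> \<le> e * (LINT x|M. norm (w x)) + e * (LINT x|N. norm (v x))"
      by (rule order_trans[OF norm_triangle_ineq4 add_mono[OF M(2) N(2)]])
    finally show ?thesis by (simp add: D_def distrib_left)
  qed
  have "norm ((LINT x|M. of_real (g (h x)) * w x) - (LINT x|N. of_real (g (k x)) * v x)) \<le> 0"
  proof (rule field_le_epsilon)
    fix e :: real assume "e > 0"
    \<comment> \<open>Dividing by \<open>D + 1\<close> instead of \<open>D\<close> keeps the
      tolerance meaningful when \<open>D = 0\<close>.\<close>
    have "norm ((LINT x|M. of_real (g (h x)) * w x) - (LINT x|N. of_real (g (k x)) * v x)) \<le> (e / (D + 1)) * D"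
      using \<open>e > 0\<close> D by (intro approx) auto
    also have "\<dots> \<le> e" using \<open>e > 0\<close> D by (simp add: field_simps)
    finally show "norm ((LINT x|M. of_real (g (h x)) * w x) - (LINT x|N. of_real (g (k x)) * v x)) \<le> 0 + e" by simp
  qed
  then show ?thesis by simp
qed

section \<open>Borel sections of a continuous function and change of variables\<close>

text \<open>\<open>h\<close> may oscillate, so a section is selected by first passage: each value
  between \<open>h a\<close> and \<open>h b\<close> has a first time at which it is attained, and
  strictness of the records gives injectivity.\<close>

lemma increasing_section:
  fixes h :: "real \<Rightarrow> real"
  assumes "a \<le> b" and cont: "continuous_on {a..b} h" and "h a \<le> h b"
  obtains S where "S \<subseteq> {a..b}" "S \<in> sets borel" "inj_on h S" "h ` S = {h a..h b}"
proof
  \<comment> \<open>the times at which \<open>h\<close> attains a new strict maximum\<close>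
  define S where "S = {t \<in> {a..b}. h t \<le> h b \<and> (\<forall>s\<in>{a..<t}. h s < h t)}"
  show "S \<subseteq> {a..b}" by (auto simp: S_def)
  show "inj_on h S"
  proof (rule linorder_inj_onI')
    fix s t assume "s \<in> S" "t \<in> S" "s < t"
    then have "h s < h t" by (auto simp: S_def)
    then show "h s \<noteq> h t" by simp
  qed
  show "h ` S = {h a..h b}"
  proof
    show "h ` S \<subseteq> {h a..h b}"
    proof (rule image_subsetI)
      fix t assume t: "t \<in> S"
      then have "h a \<le> h t" by (cases "t = a") (auto simp: S_def intro: less_imp_le)
      then show "h t \<in> {h a..h b}" using t by (auto simp: S_def)
    qed
    show "{h a..h b} \<subseteq> h ` S"
    proof
      fix v assume v: "v \<in> {h a..h b}"
      define Z where "Z = {t \<in> {a..b}. h t = v}"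
      have "Z \<noteq> {}"
        using IVT'[of h a v b] v assms by (auto simp: Z_def)
      moreover have "compact Z"
      proof -
        have "Z = {a..b} \<inter> h -` {v}" by (auto simp: Z_def)
        moreover have "closed ({a..b} \<inter> h -` {v})"
          by (intro continuous_closed_preimage cont) auto
        ultimately show ?thesis
          by (metis compact_Icc compact_Int_closed inf_left_idem)
      qed
      ultimately obtain t where t: "t \<in> Z" "\<And>s. s \<in> Z \<Longrightarrow> t \<le> s"
        using compact_attains_inf by metis
      \<comment> \<open>If \<open>h s\<close> were at least \<open>v\<close> at an earlier time, the
        intermediate value theorem on \<open>{a..s}\<close>, starting from
        \<open>h a \<le> v\<close>, would produce a hit of \<open>v\<close> before the first one,
        \<open>t\<close>.\<close>
      have "h s < h t" if s: "s \<in> {a..<t}" for s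
      proof (rule ccontr)
        assume "\<not> h s < h t"
        then have "v \<le> h s" using t by (auto simp: Z_def)
        moreover have "continuous_on {a..s} h"
          using s t(1) by (intro continuous_on_subset[OF cont]) (auto simp: Z_def)
        ultimately obtain r where "a \<le> r" "r \<le> s" "h r = v"
          using IVT'[of h a v s] v s by auto
        then have "r \<in> Z" using s t(1) by (auto simp: Z_def)
        then show False using t(2)[of r] \<open>r \<le> s\<close> s by auto
      qed
      then have "t \<in> S" using t(1) v by (auto simp: S_def Z_def)
      then show "v \<in> h ` S" using t(1) by (auto simp: Z_def)
    qed
  qed
  show "S \<in> sets borel"
  proof -
    \<comment> \<open>Keeping \<open>s\<close> at distance \<open>1/(n+1)\<close> from \<open>t\<close> makes the set of non-record times a countable
      union of projections of compact sets.\<close>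
    define Bad where "Bad n = fst ` {p \<in> {a..b} \<times> {a..b}. snd p + 1 / real (Suc n) \<le> fst p \<and> h (fst p) \<le> h (snd p)}" for n
    have "compact (Bad n)" for n
    proof -
      have 1: "closed (({a..b} \<times> {a..b}) \<inter> (\<lambda>p. (fst p - snd p, h (snd p) - h (fst p))) -` ({1 / real (Suc n)..} \<times> {0..}))"
        by (intro continuous_closed_preimage closed_Times closed_atLeastAtMost closed_atLeast
            continuous_intros continuous_on_compose2[OF cont]) auto
      have 2: "{p \<in> {a..b} \<times> {a..b}. snd p + 1 / real (Suc n) \<le> fst p \<and> h (fst p) \<le> h (snd p)}
        = ({a..b} \<times> {a..b}) \<inter> (({a..b} \<times> {a..b}) \<inter> (\<lambda>p. (fst p - snd p, h (snd p) - h (fst p))) -` ({1 / real (Suc n)..} \<times> {0..}))"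
        by (auto simp: algebra_simps)
      show ?thesis unfolding Bad_def 2
        by (intro compact_continuous_image continuous_intros compact_Int_closed[OF _ 1] compact_Times compact_Icc)
    qed
    then have [measurable]: "Bad n \<in> sets borel" for n by (intro borel_closed compact_imp_closed)
    have C: "{a..b} \<inter> h -` {..h b} \<in> sets borel"
      by (intro borel_closed continuous_closed_preimage cont) auto
    have "S = ({a..b} \<inter> h -` {..h b}) - (\<Union>n. Bad n)"
    proof (intro set_eqI iffI)
      fix t assume t: "t \<in> S"
      have "t \<notin> Bad n" for n
      proof
        assume "t \<in> Bad n"
        then obtain s where s: "a \<le> s" "s + 1 / real (Suc n) \<le> t" "h t \<le> h s"
          unfolding Bad_def by auto
        have "s < s + 1 / real (Suc n)" by simp
        then have "s < t" using s(2) by linarith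
        with s(1) have "h s < h t" using t by (simp add: S_def)
        then show False using s(3) by simp
      qed
      then show "t \<in> ({a..b} \<inter> h -` {..h b}) - (\<Union>n. Bad n)"
        using t by (auto simp: S_def)
    next
      fix t assume t: "t \<in> ({a..b} \<inter> h -` {..h b}) - (\<Union>n. Bad n)"
      have "h s < h t" if s: "s \<in> {a..<t}" for s
      proof (rule ccontr)
        assume "\<not> h s < h t"
        obtain n where "1 / real (Suc n) < t - s"
          using s nat_approx_posE[of "t - s"] by auto
        then have "t \<in> Bad n"
          unfolding Bad_def using s t \<open>\<not> h s < h t\<close> by (intro image_eqI[of _ _ "(t, s)"]) auto
        then show False using t by auto
      qed
      then show "t \<in> S" using t by (auto simp: S_def)
    qed
    then show ?thesis using C by simp
  qed
qed

text \<open>Choose times at which the end points \<open>c\<close> and \<open>d\<close> are attained.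
  If \<open>c\<close> is attained first, the increasing case applies between these times; otherwise
  it applies to \<open>- h\<close>.\<close>

lemma section_onto_subinterval:
  fixes h :: "real \<Rightarrow> real"
  assumes cont: "continuous_on {a..b} h" and sub: "{c..d} \<subseteq> h ` {a..b}" and "c \<le> d"
  obtains S where "S \<subseteq> {a..b}" "S \<in> sets borel" "inj_on h S" "h ` S = {c..d}"
proof -
  have "c \<in> h ` {a..b}" "d \<in> h ` {a..b}" using sub \<open>c \<le> d\<close> by auto
  then obtain s t where st: "s \<in> {a..b}" "t \<in> {a..b}" and c: "c = h s" and d: "d = h t" by blast
  show ?thesis
  proof (cases "s \<le> t")
    case True
    have sub: "{s..t} \<subseteq> {a..b}" using st by auto
    obtain S where S: "S \<subseteq> {s..t}" "S \<in> sets borel" "inj_on h S" "h ` S = {h s..h t}"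
      using increasing_section[OF True continuous_on_subset[OF cont sub]] \<open>c \<le> d\<close> c d by metis
    show ?thesis by (rule that[of S]) (use S sub c d in auto)
  next
    case False
    have sub: "{t..s} \<subseteq> {a..b}" using st by auto
    have "continuous_on {t..s} (\<lambda>x. - h x)"
      by (intro continuous_intros continuous_on_subset[OF cont sub])
    then obtain S where S: "S \<subseteq> {t..s}" "S \<in> sets borel" "inj_on (\<lambda>x. - h x) S"
        "(\<lambda>x. - h x) ` S = {- h t..- h s}"
      using increasing_section[of t s "\<lambda>x. - h x"] False \<open>c \<le> d\<close> c d by auto
    have "h ` S = uminus ` ((\<lambda>x. - h x) ` S)" by (simp add: image_image)
    also have "\<dots> = {c..d}" unfolding S(4) c d by simp
    finally have im: "h ` S = {c..d}" .
    show ?thesis by (rule that[of S, OF _ _ _ im]) (use S sub in \<open>auto simp: inj_on_def\<close>)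
  qed
qed

text \<open>The weight is the Jacobian \<open>\<bar>h' t\<bar>\<close> cut off to an injective
  section over \<open>{c..d}\<close>, so that its push-forward under \<open>h\<close> is Lebesgue
  measure on \<open>{c..d}\<close>. Continuity of \<open>h'\<close> on the compact interval makes it
  bounded, which later places the preimage in the \<open>L2_space\<close>.\<close>

lemma weight_onto_subinterval:
  fixes h h' :: "real \<Rightarrow> real"
  assumes deriv: "\<forall>t\<in>{a..b}. (h has_field_derivative h' t) (at t within {a..b})"
    and h': "continuous_on {a..b} h'"
    and sub: "{c..d} \<subseteq> h ` {a..b}" and "c \<le> d"
  shows "\<exists>\<rho>\<in>borel_measurable (lebesgue_on {a..b}). (\<exists>C. \<forall>t\<in>{a..b}. \<bar>\<rho> t\<bar> \<le> C) \<and>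
    (\<forall>f :: real \<Rightarrow> complex. continuous_on {c..d} f \<longrightarrow>
      (LINT t|lebesgue_on {a..b}. f (h t) * of_real (\<rho> t)) = integral {c..d} f)"
proof -
  have "continuous_on {a..b} h"
    using deriv DERIV_continuous continuous_on_eq_continuous_within by blast
  then obtain S where S: "S \<subseteq> {a..b}" "S \<in> sets borel" "inj_on h S" "h ` S = {c..d}"
    using section_onto_subinterval[OF _ sub \<open>c \<le> d\<close>] by metis
  have S_leb: "S \<in> sets lebesgue" using S(2) by simp
  define \<rho> where "\<rho> t = (indicator S t * \<bar>h' t\<bar> :: real)" for t
  have "bounded (h' ` {a..b})"
    by (intro compact_imp_bounded compact_continuous_image h' compact_Icc)
  then obtain C where C: "C > 0" "\<And>t. t \<in> {a..b} \<Longrightarrow> \<bar>h' t\<bar> \<le> C"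
    by (auto simp: bounded_pos)
  show ?thesis
  proof (intro bexI[of _ \<rho>] conjI allI impI exI[of _ C] ballI)
    have [measurable]: "h' \<in> borel_measurable (lebesgue_on {a..b})"
      by (rule continuous_imp_measurable_on_sets_lebesgue[OF h']) simp
    have [measurable]: "S \<in> sets (lebesgue_on {a..b})"
      using S_leb S(1) by (subst sets_restrict_space_iff) auto
    show "\<rho> \<in> borel_measurable (lebesgue_on {a..b})"
      unfolding \<rho>_def by measurable
  next
    fix t assume "t \<in> {a..b}"
    then show "\<bar>\<rho> t\<bar> \<le> C"
      using C by (auto simp: \<rho>_def indicator_def)
  next
    fix f :: "real \<Rightarrow> complex" assume f: "continuous_on {c..d} f"
    have "f absolutely_integrable_on h ` S"
      unfolding S(4) using f by (rule absolutely_integrable_continuous_real)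
    then have *: "(\<lambda>t. \<bar>h' t\<bar> *\<^sub>R f (h t)) absolutely_integrable_on S"
        "integral S (\<lambda>t. \<bar>h' t\<bar> *\<^sub>R f (h t)) = integral (h ` S) f"
      using has_absolute_integral_change_of_variables_real[OF S_leb _ S(3), of h' f "integral (h ` S) f"]
        has_field_derivative_subset[OF bspec[OF deriv] S(1)] S(1) by blast+
    have "(LINT t|lebesgue_on {a..b}. f (h t) * of_real (\<rho> t))
        = (LINT t|lebesgue_on {a..b}. (if t \<in> S then \<bar>h' t\<bar> *\<^sub>R f (h t) else 0))"
      by (intro Bochner_Integration.integral_cong) (auto simp: \<rho>_def scaleR_conv_of_real)
    also have "\<dots> = (LINT t|lebesgue_on S. \<bar>h' t\<bar> *\<^sub>R f (h t))"
      using S(1) S_leb by (subst Lebesgue_Measure.integral_restrict_Int) (auto simp: Int_absorb2)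
    also have "\<dots> = integral S (\<lambda>t. \<bar>h' t\<bar> *\<^sub>R f (h t))"
      by (intro lebesgue_integral_eq_integral absolutely_integrable_imp_integrable * S_leb)
    finally show "(LINT t|lebesgue_on {a..b}. f (h t) * of_real (\<rho> t)) = integral {c..d} f"
      unfolding *(2) S(4) .
  qed
qed

section \<open>Square integrability on bounded intervals\<close>

text \<open>On a set of finite measure \<open>r \<le> 1 + r\<^sup>2\<close> gives integrability. The
  passage from the open to the closed interval, over which the operator integrates, adds only two
  points, where the values of \<open>\<psi>\<close> are arbitrary.\<close>

lemma L2_space_imp_integrable:
  assumes "\<psi> \<in> L2_space {a<..<b}"
  shows "integrable (lebesgue_on {a..b}) \<psi>"
proof -
  have [measurable]: "\<psi> \<in> borel_measurable (lebesgue_on {a<..<b})"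
    and int: "integrable (lebesgue_on {a<..<b}) (\<lambda>x. (norm (\<psi> x))\<^sup>2)"
    using assms by (auto simp: L2_space_def)
  have "integrable (lebesgue_on {a<..<b}) \<psi>"
  proof (rule Bochner_Integration.integrable_bound)
    have "finite_measure (lebesgue_on {a<..<b})"
      by (rule finite_measure_lebesgue_on) simp
    then show "integrable (lebesgue_on {a<..<b}) (\<lambda>x. 1 + (norm (\<psi> x))\<^sup>2)"
      using int by (intro Bochner_Integration.integrable_add finite_measure.integrable_const)
    have "r \<le> 1 + r\<^sup>2" for r :: real
      using zero_le_power2[of "r - 1/2"] by (simp add: power2_eq_square algebra_simps)
    then show "AE x in lebesgue_on {a<..<b}. norm (\<psi> x) \<le> norm (1 + (norm (\<psi> x))\<^sup>2)"
      by (intro AE_I2) (simp add: abs_of_nonneg)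
  qed measurable
  then have abs_int: "\<psi> absolutely_integrable_on {a<..<b}"
    by (simp add: set_integrable_def integrable_restrict_space)
  have "negligible {x \<in> {a..b} - {a<..<b}. \<psi> x \<noteq> 0}"
    by (rule negligible_subset[of "{a, b}"]) auto
  moreover have "negligible {x \<in> {a<..<b} - {a..b}. \<psi> x \<noteq> 0}"
    by (rule negligible_subset[of "{}"]) auto
  ultimately have "\<psi> absolutely_integrable_on {a..b}"
    using absolutely_integrable_spike_set_eq[of "{a<..<b}" "{a..b}" \<psi>] abs_int by blast
  then show ?thesis by (intro absolutely_integrable_imp_integrable) auto
qed

lemma L2_space_bounded:
  assumes f: "f \<in> borel_measurable (lebesgue_on {a<..<b})"
    and C: "\<And>x. x \<in> {a<..<b} \<Longrightarrow> norm (f x) \<le> C"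
  shows "f \<in> L2_space {a<..<b}"
proof -
  have "finite_measure (lebesgue_on {a<..<b})"
    by (rule finite_measure_lebesgue_on) simp
  moreover have "AE x in lebesgue_on {a<..<b}. norm ((norm (f x))\<^sup>2) \<le> C\<^sup>2"
    using C by (intro AE_I2) (auto intro: power_mono)
  ultimately have "integrable (lebesgue_on {a<..<b}) (\<lambda>x. (norm (f x))\<^sup>2)"
    using f by (intro finite_measure.integrable_const_bound) measurable
  with f show ?thesis by (simp add: L2_space_def)
qed

section \<open>The test function\<close>

text \<open>A translation exhibits the test function as the normalised Fourier transform of the
  indicator of the shifted interval, in the form that \<open>weight_onto_subinterval\<close>
  delivers.\<close>

lemma test_function_eq_integral:
  "test_function tmin tmax xhat y k =
     of_real (1 / \<bar>tmax - tmin\<bar>) *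
     integral {xhat \<bullet> y + tmin..xhat \<bullet> y + tmax} (\<lambda>s. exp (- \<i> * of_real k * of_real s))"
proof -
  have "(\<lambda>t. exp (- \<i> * of_real k * of_real (xhat \<bullet> y + t))) absolutely_integrable_on {tmin..tmax}"
    by (intro absolutely_integrable_continuous_real continuous_intros)
  then have "(LINT t|lebesgue_on {tmin..tmax}. exp (- \<i> * of_real k * of_real (xhat \<bullet> y + t)))
      = integral {tmin..tmax} ((\<lambda>s. exp (- \<i> * of_real k * of_real s)) \<circ> (+) (xhat \<bullet> y))"
    by (subst lebesgue_integral_eq_integral) (simp_all add: o_def absolutely_integrable_imp_integrable)
  also have "\<dots> = integral {tmin + xhat \<bullet> y..tmax + xhat \<bullet> y} (\<lambda>s. exp (- \<i> * of_real k * of_real s))"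
    by (rule integral_shift_Icc_real)
  finally show ?thesis by (simp add: test_function_def add.commute)
qed

text \<open>The range is defined inside \<open>L2_space {0<..<K}\<close>, so this membership must be
  supplied too. It follows from continuity in \<open>k\<close>, hence boundedness on
  \<open>{0..K}\<close>.\<close>

lemma test_function_in_L2_space: "test_function tmin tmax xhat y \<in> L2_space {0<..<K}"
proof -
  define c d where "c = xhat \<bullet> y + tmin" and "d = xhat \<bullet> y + tmax"
  have "continuous_on UNIV (\<lambda>k. integral (cbox c d) (\<lambda>s. exp (- \<i> * of_real k * of_real s)))"
    by (rule integral_continuous_on_param) (auto simp: split_def intro!: continuous_intros)
  then have "continuous_on UNIV (\<lambda>k. of_real (1 / \<bar>tmax - tmin\<bar>) *
      integral (cbox c d) (\<lambda>s. exp (- \<i> * of_real k * of_real s)))"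
    by (intro continuous_intros)
  then have cont: "continuous_on UNIV (test_function tmin tmax xhat y)"
    by (simp add: c_def d_def test_function_eq_integral[abs_def])
  have "bounded (test_function tmin tmax xhat y ` {0..K})"
    by (intro compact_imp_bounded compact_continuous_image continuous_on_subset[OF cont]) auto
  then obtain C where "\<forall>z\<in>test_function tmin tmax xhat y ` {0..K}. norm z \<le> C"
    unfolding bounded_iff by (elim exE)
  then show ?thesis
    by (intro L2_space_bounded[of _ _ _ C] continuous_imp_measurable_on_sets_lebesgue
        continuous_on_subset[OF cont]) auto
qed

section \<open>The range criterion: containment of the shifted interval in the image of
  \<open>h\<close>\<close>

text \<open>The pairs (\<open>h\<close>, \<open>\<psi>\<close>) and (\<open>k\<close>,
  \<open>v\<close>) have the same Fourier transform almost everywhere on \<open>(0,K)\<close>, hence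
  the same moments. Testing with the distance to the image of \<open>h\<close> annihilates the first
  side and detects any point of the image of \<open>k\<close> outside it.\<close>

lemma test_function_in_range_imp_subset:
  fixes a :: "real \<Rightarrow> real ^ 'd"
  assumes "tmin < tmax" "K > 0" and a: "continuous_on {tmin..tmax} a"
    and rng: "test_function tmin tmax xhat y \<in> data_to_pattern_range a tmin tmax K xhat"
  shows "{xhat \<bullet> y + tmin..xhat \<bullet> y + tmax} \<subseteq> (\<lambda>t. t + xhat \<bullet> a t) ` {tmin..tmax}"
proof -
  define h where "h t = t + xhat \<bullet> a t" for t
  define k where "k t = xhat \<bullet> y + t" for t
  define M where "M = lebesgue_on {tmin..tmax}"
  obtain \<psi> where \<psi>: "\<psi> \<in> L2_space {tmin<..<tmax}"
    and AE: "AE \<tau> in lebesgue_on {0<..<K}. test_function tmin tmax xhat y \<tau> = data_to_pattern a tmin tmax xhat \<psi> \<tau>"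
    using rng by (auto simp: data_to_pattern_range_def)
  define v where "v = (\<lambda>t::real. complex_of_real (1 / \<bar>tmax - tmin\<bar>))"
  have h: "continuous_on {tmin..tmax} h" and k: "continuous_on {tmin..tmax} k"
    unfolding h_def k_def by (intro continuous_intros a)+
  have "compact (h ` {tmin..tmax} \<union> k ` {tmin..tmax})"
    by (intro compact_Un compact_continuous_image h k compact_Icc)
  then have "bounded (h ` {tmin..tmax} \<union> k ` {tmin..tmax})" by (rule compact_imp_bounded)
  \<comment> \<open>One bound for both functions, since the moment lemmas compare them on a common
    interval.\<close>
  then obtain B where B: "\<forall>x\<in>h ` {tmin..tmax} \<union> k ` {tmin..tmax}. \<bar>x\<bar> \<le> B"
    unfolding bounded_iff real_norm_def by (elim exE)
  have hm: "h \<in> borel_measurable M" and km: "k \<in> borel_measurable M"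
    unfolding M_def by (auto intro!: continuous_imp_measurable_on_sets_lebesgue h k)
  have wi: "integrable M \<psi>" unfolding M_def by (rule L2_space_imp_integrable[OF \<psi>])
  have vi: "integrable M v"
    unfolding M_def v_def by (intro finite_measure.integrable_const finite_measure_lebesgue_on) simp
  have hB: "\<bar>h x\<bar> \<le> B" and kB: "\<bar>k x\<bar> \<le> B" if "x \<in> space M" for x
    using that B by (auto simp: M_def)
  have "AE \<tau> in lebesgue_on {0<..<K}.
      (LINT x|M. exp (- \<i> * of_real \<tau> * of_real (h x)) * \<psi> x) =
      (LINT x|M. exp (- \<i> * of_real \<tau> * of_real (k x)) * v x)"
    using AE
  proof eventually_elim
    case (elim \<tau>)
    have "(LINT x|M. exp (- \<i> * of_real \<tau> * of_real (k x)) * v x) = test_function tmin tmax xhat y \<tau>"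
      unfolding v_def test_function_def M_def k_def by (simp add: mult.commute)
    then show ?case using elim
      unfolding data_to_pattern_def M_def h_def by simp
  qed
  note mom = moments_eq_of_fourier_eq[OF wi hm hB vi km kB \<open>K > 0\<close> this]
  define g where "g s = infdist s (h ` {tmin..tmax})" for s
  have g: "continuous_on UNIV g" unfolding g_def by (intro continuous_intros)
  have "(LINT x|M. of_real (g (h x)) * \<psi> x) = (LINT x|M. of_real (g (k x)) * v x)"
    by (rule integral_continuous_eq_of_moments_eq[OF wi hm hB vi km kB mom g])
  moreover have "(LINT x|M. of_real (g (h x)) * \<psi> x) = (LINT x|M. 0)"
    by (intro Bochner_Integration.integral_cong) (auto simp: M_def g_def)
  ultimately have "(LINT x|M. complex_of_real (g (k x))) = 0"
    using \<open>tmin < tmax\<close> by (simp add: v_def)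
  then have "(LINT x|M. g (k x)) = 0" by simp
  moreover have "continuous_on {tmin..tmax} (\<lambda>x. g (k x))"
    by (rule continuous_on_compose2[OF g k]) simp
  \<comment> \<open>A continuous nonnegative function with integral zero vanishes at every point.
    Closedness of the image then turns distance zero into membership.\<close>
  ultimately have "\<forall>x\<in>{tmin..tmax}. g (k x) = 0"
    using integralL_eq_0_iff[of tmin tmax "\<lambda>x. g (k x)"] \<open>tmin < tmax\<close>
    by (simp add: M_def g_def infdist_nonneg)
  moreover have "closed (h ` {tmin..tmax})"
    by (intro compact_imp_closed compact_continuous_image h compact_Icc)
  ultimately have "k ` {tmin..tmax} \<subseteq> h ` {tmin..tmax}"
    using \<open>tmin < tmax\<close> by (auto simp: g_def in_closed_iff_infdist_zero)
  moreover have "k ` {tmin..tmax} = {xhat \<bullet> y + tmin..xhat \<bullet> y + tmax}"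
    unfolding k_def by simp
  ultimately show ?thesis by (simp add: h_def[abs_def])
qed

text \<open>The weight for \<open>h\<close> over the shifted interval, divided by the length of the
  time interval, is an explicit preimage. It reproduces the test function for every
  \<open>\<tau>\<close>, not just almost everywhere.\<close>

lemma subset_imp_test_function_in_range:
  fixes a :: "real \<Rightarrow> real ^ 'd"
  assumes "tmin < tmax" and a: "C1_on_interval tmin tmax a"
    and sub: "{xhat \<bullet> y + tmin..xhat \<bullet> y + tmax} \<subseteq> (\<lambda>t. t + xhat \<bullet> a t) ` {tmin..tmax}"
  shows "test_function tmin tmax xhat y \<in> data_to_pattern_range a tmin tmax K xhat"
proof -
  define h where "h t = t + xhat \<bullet> a t" for t
  obtain a' where a': "\<And>t. t \<in> {tmin..tmax} \<Longrightarrow> (a has_vector_derivative a' t) (at t within {tmin..tmax})"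
    and cont: "continuous_on {tmin..tmax} a'"
    using a unfolding C1_on_interval_def by blast
  have deriv: "\<forall>t\<in>{tmin..tmax}. (h has_field_derivative 1 + xhat \<bullet> a' t) (at t within {tmin..tmax})"
    unfolding h_def has_real_derivative_iff_has_vector_derivative
    by (intro ballI has_vector_derivative_add has_vector_derivative_id
        bounded_linear.has_vector_derivative[OF bounded_linear_inner_right] a')
  have cont': "continuous_on {tmin..tmax} (\<lambda>t. 1 + xhat \<bullet> a' t)"
    by (intro continuous_intros cont)
  have sub': "{xhat \<bullet> y + tmin..xhat \<bullet> y + tmax} \<subseteq> h ` {tmin..tmax}"
    using sub by (simp add: h_def[abs_def])
  have "xhat \<bullet> y + tmin \<le> xhat \<bullet> y + tmax" using \<open>tmin < tmax\<close> by simp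
  from weight_onto_subinterval[OF deriv cont' sub' this]
  obtain \<rho> C where [measurable]: "\<rho> \<in> borel_measurable (lebesgue_on {tmin..tmax})"
    and C: "\<forall>t\<in>{tmin..tmax}. \<bar>\<rho> t\<bar> \<le> C"
    and int: "\<forall>f :: real \<Rightarrow> complex. continuous_on {xhat \<bullet> y + tmin..xhat \<bullet> y + tmax} f \<longrightarrow>
      (LINT t|lebesgue_on {tmin..tmax}. f (h t) * of_real (\<rho> t)) = integral {xhat \<bullet> y + tmin..xhat \<bullet> y + tmax} f"
    by (elim bexE conjE exE) rule
  define \<psi> where "\<psi> t = complex_of_real (1 / \<bar>tmax - tmin\<bar> * \<rho> t)" for t
  have "\<psi> \<in> borel_measurable (lebesgue_on {tmin..tmax})"
    unfolding \<psi>_def by measurable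
  then have "\<psi> \<in> borel_measurable (lebesgue_on {tmin<..<tmax})"
    by (rule measurable_restrict_mono) auto
  then have "\<psi> \<in> L2_space {tmin<..<tmax}"
  proof (rule L2_space_bounded)
    show "norm (\<psi> t) \<le> 1 / \<bar>tmax - tmin\<bar> * C" if "t \<in> {tmin<..<tmax}" for t
      using bspec[OF C, of t] that unfolding \<psi>_def norm_of_real abs_mult by (auto intro!: mult_left_mono divide_right_mono)
  qed
  moreover have "test_function tmin tmax xhat y \<tau> = data_to_pattern a tmin tmax xhat \<psi> \<tau>" for \<tau>
  proof -
    have "data_to_pattern a tmin tmax xhat \<psi> \<tau> =
        (LINT t|lebesgue_on {tmin..tmax}. of_real (1 / \<bar>tmax - tmin\<bar>) * (exp (- \<i> * of_real \<tau> * of_real (h t)) * of_real (\<rho> t)))"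
      unfolding data_to_pattern_def \<psi>_def h_def by (simp add: mult_ac)
    \<comment> \<open>The property of \<open>\<rho>\<close> is used with the exponential
      \<open>s \<mapsto> exp (- \<i> * of_real \<tau> * of_real s)\<close>.\<close>
    also have "\<dots> = test_function tmin tmax xhat y \<tau>"
      unfolding test_function_eq_integral
      by (subst integral_mult_right_zero, subst int[rule_format]) (intro continuous_intros refl)+
    finally show ?thesis by simp
  qed
  ultimately show ?thesis
    using test_function_in_L2_space by (auto simp: data_to_pattern_range_def)
qed

section \<open>Translation into observability and \<open>K_Gamma\<close>\<close>

theorem lemma3p10:
  fixes a :: "real \<Rightarrow> real ^ 'd" and tmin tmax K :: real and xhat :: "real ^ 'd"
  assumes "CARD('d) = 2 \<or> CARD('d) = 3"
    and "0 < tmin" and "tmin < tmax" and "K > 0"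
    and "C1_on_interval tmin tmax a"
    and "xhat \<in> sphere 0 1"
  shows "(non_observable a tmin tmax xhat \<longrightarrow>
            (\<forall>y. test_function tmin tmax xhat y \<notin> data_to_pattern_range a tmin tmax K xhat)) \<and>
         (observable a tmin tmax xhat \<longrightarrow>
            (\<forall>y. test_function tmin tmax xhat y \<in> data_to_pattern_range a tmin tmax K xhat
                 \<longleftrightarrow> y \<in> K_Gamma a tmin tmax xhat))"
proof -
  have a: "continuous_on {tmin..tmax} a"
    using assms(5) has_vector_derivative_continuous
    unfolding C1_on_interval_def continuous_on_eq_continuous_within by blast
  then have "continuous_on {tmin..tmax} (\<lambda>t. t + xhat \<bullet> a t)"
    by (intro continuous_intros)
  \<comment> \<open>The image is a compact interval, so its end points are \<open>xi_min\<close> and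
    \<open>xi_max\<close>, and containment becomes a pair of inequalities.\<close>
  then obtain p q where im: "(\<lambda>t. t + xhat \<bullet> a t) ` {tmin..tmax} = {p..q}" and "p \<le> q"
    using continuous_image_closed_interval[of tmin tmax] \<open>tmin < tmax\<close> by (metis less_imp_le)
  have p: "xi_min a tmin tmax xhat = p" and q: "xi_max a tmin tmax xhat = q"
    using im \<open>p \<le> q\<close> by (simp_all add: xi_min_def xi_max_def add.commute)
  have key: "test_function tmin tmax xhat y \<in> data_to_pattern_range a tmin tmax K xhat \<longleftrightarrow>
      p \<le> xhat \<bullet> y + tmin \<and> xhat \<bullet> y + tmax \<le> q" for y
  proof
    assume "test_function tmin tmax xhat y \<in> data_to_pattern_range a tmin tmax K xhat"
    then show "p \<le> xhat \<bullet> y + tmin \<and> xhat \<bullet> y + tmax \<le> q"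
      using test_function_in_range_imp_subset[OF assms(3,4) a, of xhat y] assms(3) unfolding im by simp
  next
    assume "p \<le> xhat \<bullet> y + tmin \<and> xhat \<bullet> y + tmax \<le> q"
    then show "test_function tmin tmax xhat y \<in> data_to_pattern_range a tmin tmax K xhat"
      by (intro subset_imp_test_function_in_range[OF assms(3,5)]) (simp add: im)
  qed
  \<comment> \<open>The shifted interval has length \<open>tmax - tmin\<close> and cannot fit into a
    shorter image, whatever the shift \<open>c\<close>.\<close>
  have "\<not> (p \<le> c + tmin \<and> c + tmax \<le> q)" if "q - p < tmax - tmin" for c
    using that by linarith
  moreover have "(p \<le> c + tmin \<and> c + tmax \<le> q) \<longleftrightarrow> (p - tmin \<le> c \<and> c \<le> q - tmax)" for c
    by linarith
  ultimately show ?thesis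
    by (simp add: key non_observable_def K_Gamma_def p q)
qed

end
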